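(* Let $\mathbb{k}$ be an arbitrary field and let $n\le 7$ be a positive integer. For $C,C'\in\mathcal M_n$, the diagonally graded commutative algebras $\mathfrak p(C)$ and $\mathfrak p(C')$ are isomorphic (as graded algebras) if and only if $C\sim C'$. Namely, the set of isomorphism classes of $n$-dimensional diagonally graded commutative algebras over $\mathbb{k}$ is in bijection with the quotient set $\mathcal M_n/\sim$. In particular, the algebras $\mathfrak p(C)$ with $C$ ranging over all $(0,1)$-matrices in $\mathcal M_n$ form a system of representatives of the isomorphism classes of $n$-dimensional diagonally graded commutative algebras (exactly one for each class).
   Context: $[n]=\{1,\dots,n\}$. $\mathcal M_n$ is the set of $n\times n$ symmetric matrices $C=(c_{ij})_{i,j\in[n]}$ over $\mathbb{k}$ with $c_{ij}=0$ if $i+j>n$ and $c_{jk}c_{i,j+k}=c_{ij}c_{i+j,k}$ for all $i,j,k\ge 1$ (where $c_{ij}$ is read as $0$ whenever $i+j>n$, including when an index exceeds $n$). For $C\in\mathcal M_n$, the $n$-dimensional diagonally graded commutative algebra (DGCA) $\mathfrak p(C)$ is the $\mathbb N^+$-graded vector space $\mathfrak p$ with fixed basis $p_1,\dots,p_n$, $\deg p_i=i$, with multiplication $p_ip_j=c_{ij}p_{i+j}$ (where $p_m=0$ for $m>n$); it is a commutative associative graded algebra (not unital). Every $n$-dimensional DGCA is by definition of this form. An isomorphism of graded algebras is a degree-preserving linear isomorphism $\varphi$ with $\varphi(xy)=\varphi(x)\varphi(y)$. The equivalence relation $\sim$ on $\mathcal M_n$: $C\sim C'$ iff the distributions of nonzero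 entries coincide, i.e. for all $i,j$, $c_{ij}\ne0\Leftrightarrow c'_{ij}\ne0$. Each $\sim$-class contains a unique $(0,1)$-matrix. *)

theory Defs
  imports Main
begin

text \<open>
  Graded algebras over a field \<open>'k\<close>, not necessarily unital, on a carrier set.
  The field \<open>gcomp A d\<close> is the homogeneous component of degree \<open>d\<close>; only degrees \<open>d \<ge> 1\<close> matter.
\<close>

record ('k, 'v) graded_algebra =
  gcarrier :: "'v set"
  gadd :: "'v \<Rightarrow> 'v \<Rightarrow> 'v"
  gscale :: "'k \<Rightarrow> 'v \<Rightarrow> 'v"
  gmult :: "'v \<Rightarrow> 'v \<Rightarrow> 'v"
  gcomp :: "nat \<Rightarrow> 'v set"

definition graded_algebra_iso ::
    "('k, 'v) graded_algebra \<Rightarrow> ('k, 'w) graded_algebra \<Rightarrow> ('v \<Rightarrow> 'w) \<Rightarrow> bool" where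
  "graded_algebra_iso A B \<phi> \<longleftrightarrow>
     bij_betw \<phi> (gcarrier A) (gcarrier B) \<and>
     (\<forall>x\<in>gcarrier A. \<forall>y\<in>gcarrier A. \<phi> (gadd A x y) = gadd B (\<phi> x) (\<phi> y)) \<and>
     (\<forall>a. \<forall>x\<in>gcarrier A. \<phi> (gscale A a x) = gscale B a (\<phi> x)) \<and>
     (\<forall>x\<in>gcarrier A. \<forall>y\<in>gcarrier A. \<phi> (gmult A x y) = gmult B (\<phi> x) (\<phi> y)) \<and>
     (\<forall>d\<ge>1. \<phi> ` gcomp A d \<subseteq> gcomp B d)"

definition graded_isomorphic ::
    "('k, 'v) graded_algebra \<Rightarrow> ('k, 'w) graded_algebra \<Rightarrow> bool" where
  "graded_isomorphic A B \<longleftrightarrow> (\<exists>\<phi>. graded_algebra_iso A B \<phi>)"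

text \<open>
  Matrices are functions on pairs of indices, extended by zero outside \<open>{1..n} \<times> {1..n}\<close>
  (so equality of functions is equality of matrices, and entries with an index exceeding \<open>n\<close>
  read as zero).
\<close>

definition structure_matrices :: "nat \<Rightarrow> (nat \<Rightarrow> nat \<Rightarrow> 'k::field) set" where
  "structure_matrices n =
     {c. (\<forall>i j. i \<notin> {1..n} \<or> j \<notin> {1..n} \<longrightarrow> c i j = 0) \<and>
         (\<forall>i j. c i j = c j i) \<and>
         (\<forall>i j. i + j > n \<longrightarrow> c i j = 0) \<and>
         (\<forall>i\<ge>1. \<forall>j\<ge>1. \<forall>k\<ge>1. c j k * c i (j + k) = c i j * c (i + j) k)}"

text \<open>
  The space with basis \<open>p\<^sub>1, \<dots>, p\<^sub>n\<close>: a vector is its family of coordinates, extended by zero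
  outside \<open>{1..n}\<close>. The product is the bilinear extension of \<open>p\<^sub>i p\<^sub>j = c\<^sub>i\<^sub>j p\<^sub>i\<^sub>+\<^sub>j\<close>; see
  \<open>gmult_basis\<close> below.
\<close>

definition dgca_basis :: "nat \<Rightarrow> nat \<Rightarrow> 'k::field" where
  "dgca_basis i = (\<lambda>m. if m = i then 1 else 0)"

definition dgca_of :: "nat \<Rightarrow> (nat \<Rightarrow> nat \<Rightarrow> 'k::field) \<Rightarrow> ('k, nat \<Rightarrow> 'k) graded_algebra" where
  "dgca_of n c =
     \<lparr> gcarrier = {x. \<forall>m. m \<notin> {1..n} \<longrightarrow> x m = 0},
       gadd = (\<lambda>x y m. x m + y m),
       gscale = (\<lambda>a x m. a * x m),
       gmult = (\<lambda>x y m. \<Sum>i=1..n. \<Sum>j=1..n. x i * y j * c i j * dgca_basis (i + j) m),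
       gcomp = (\<lambda>d. {x. (\<forall>m. m \<notin> {1..n} \<longrightarrow> x m = 0) \<and> (\<forall>m. m \<noteq> d \<longrightarrow> x m = 0)}) \<rparr>"

definition dgcas :: "nat \<Rightarrow> ('k::field, nat \<Rightarrow> 'k) graded_algebra set" where
  "dgcas n = dgca_of n ` structure_matrices n"

definition dgca_iso_rel ::
    "nat \<Rightarrow> (('k::field, nat \<Rightarrow> 'k) graded_algebra \<times> ('k, nat \<Rightarrow> 'k) graded_algebra) set" where
  "dgca_iso_rel n = {(A, B). A \<in> dgcas n \<and> B \<in> dgcas n \<and> graded_isomorphic A B}"

definition same_support_rel ::
    "nat \<Rightarrow> ((nat \<Rightarrow> nat \<Rightarrow> 'k::field) \<times> (nat \<Rightarrow> nat \<Rightarrow> 'k)) set" where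
  "same_support_rel n =
     {(c, c'). c \<in> structure_matrices n \<and> c' \<in> structure_matrices n \<and>
               (\<forall>i j. c i j \<noteq> 0 \<longleftrightarrow> c' i j \<noteq> 0)}"

definition zero_one_matrices :: "nat \<Rightarrow> (nat \<Rightarrow> nat \<Rightarrow> 'k::field) set" where
  "zero_one_matrices n = {c \<in> structure_matrices n. \<forall>i j. c i j = 0 \<or> c i j = 1}"

lemma gmult_basis:
  assumes "c \<in> structure_matrices n" "i \<in> {1..n}" "j \<in> {1..n}"
  shows "gmult (dgca_of n c) (dgca_basis i) (dgca_basis j) =
         gscale (dgca_of n c) (c i j) (dgca_basis (i + j))"
proof
  fix m
  have "(\<Sum>i'=1..n. \<Sum>j'=1..n. dgca_basis i i' * dgca_basis j j' * c i' j' * dgca_basis (i' + j') m)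
      = (\<Sum>i'=1..n. if i' = i then (\<Sum>j'=1..n. if j' = j then c i j * dgca_basis (i + j) m else 0) else 0)"
    (is "(\<Sum>i'=1..n. ?f i') = (\<Sum>i'=1..n. ?g i')")
  proof (intro sum.cong refl)
    fix i'
    have "?f i' = (\<Sum>j'=1..n. if j' = j then dgca_basis i i' * c i' j * dgca_basis (i' + j) m else 0)"
      by (rule sum.cong) (auto simp: dgca_basis_def[of j])
    then show "?f i' = ?g i'"
      using assms by (auto simp: dgca_basis_def[of i])
  qed
  also have "\<dots> = c i j * dgca_basis (i + j) m"
    using assms by simp
  finally show "gmult (dgca_of n c) (dgca_basis i) (dgca_basis j) m =
      gscale (dgca_of n c) (c i j) (dgca_basis (i + j)) m"
    by (simp add: dgca_of_def)
qed

lemma equiv_same_support_rel: "equiv (structure_matrices n) (same_support_rel n)"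
  unfolding same_support_rel_def
  by (rule equivI) (auto simp: refl_on_def sym_def trans_def)

end

theory Submission
  imports Defs
begin

text \<open>
  A graded isomorphism between two diagonally graded algebras can only rescale the basis,
  \<open>p\<^sub>i \<mapsto> t\<^sub>i p\<^sub>i\<close> with all \<open>t\<^sub>i \<noteq> 0\<close>, because the homogeneous components are lines. It exists iff
  \<open>c\<^sub>i\<^sub>j t\<^sub>i\<^sub>+\<^sub>j = t\<^sub>i t\<^sub>j c'\<^sub>i\<^sub>j\<close> is solvable in nonzero \<open>t\<^sub>i\<close>; this relation is called rescaling equivalence here.
  It visibly preserves supports, for every \<open>n\<close>. The converse is where \<open>n \<le> 7\<close> matters, and it comes
  down to \<open>rescaling_equivalent_support_matrix\<close>: every structure matrix can be rescaled to the
  \<open>(0,1)\<close>-matrix with the same support. Two matrices with equal supports are then both equivalent to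
  the same matrix.

  Extending by zero makes a structure matrix of size \<open>n \<le> 7\<close> one of size 7, so there are only twelve
  entries \<open>c\<^sub>i\<^sub>j\<close> with \<open>i \<le> j\<close> to make equal to 1, and each nonzero one imposes one monomial equation on
  \<open>t\<^sub>1, \<dots>, t\<^sub>7\<close>. The first row can always be normalised: \<open>c\<^sub>1\<^sub>j \<noteq> 0\<close> prescribes the ratio of \<open>t\<^sub>j\<^sub>+\<^sub>1\<close> to
  \<open>t\<^sub>j\<close>, and these conditions never conflict. Afterwards the indices split into chains, \<open>j\<close> and \<open>j + 1\<close>
  being linked when \<open>c\<^sub>1\<^sub>j = 1\<close>, and, once \<open>t\<^sub>1 = 1\<close> is chosen, the remaining freedom is one scalar per
  chain that does not contain 1. Associativity now makes enough of the entries vanish, or agree with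
  one another, for these scalars to normalise \<open>c\<^sub>2\<^sub>2, c\<^sub>2\<^sub>3, c\<^sub>2\<^sub>4, c\<^sub>2\<^sub>5, c\<^sub>3\<^sub>3, c\<^sub>3\<^sub>4\<close> too. If \<open>c\<^sub>1\<^sub>1 \<noteq> 0\<close> the
  second row is determined by the first, since \<open>p\<^sub>2\<close> is a multiple of \<open>p\<^sub>1\<^sup>2\<close>. If \<open>c\<^sub>1\<^sub>1 = 0\<close> the first row
  has no two adjacent nonzero entries.

  Solvability over an arbitrary field requires that no root has to be extracted. The delicate
  degree is 6, where \<open>(p\<^sub>2p\<^sub>2)p\<^sub>2\<close> and \<open>p\<^sub>3p\<^sub>3\<close> may both be nonzero: then the ratio \<open>t\<^sub>2\<^sup>3 / t\<^sub>3\<^sup>2\<close> is prescribed,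
  and since the exponents are coprime, \<open>t\<^sub>2 = t\<^sub>3\<close> equal to the prescribed ratio solves this.
\<close>

section \<open>Rescaling of basis vectors\<close>

definition rescaling_equivalent ::
    "(nat \<Rightarrow> nat \<Rightarrow> 'k::field) \<Rightarrow> (nat \<Rightarrow> nat \<Rightarrow> 'k) \<Rightarrow> bool" where
  "rescaling_equivalent c c' \<longleftrightarrow>
     (\<exists>t. (\<forall>i. t i \<noteq> 0) \<and> (\<forall>i j. c i j * t (i + j) = t i * t j * c' i j))"

definition support_matrix :: "(nat \<Rightarrow> nat \<Rightarrow> 'k::field) \<Rightarrow> nat \<Rightarrow> nat \<Rightarrow> 'k" where
  "support_matrix c i j = (if c i j = 0 then 0 else 1)"

lemma rescaling_equivalentI:
  assumes "\<And>i. t i \<noteq> 0" "\<And>i j. c i j * t (i + j) = t i * t j * c' i j"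
  shows "rescaling_equivalent c c'"
  using assms unfolding rescaling_equivalent_def by blast

lemma rescaling_equivalent_sym:
  assumes "rescaling_equivalent c c'"
  shows "rescaling_equivalent c' c"
proof -
  obtain t where t: "\<And>i. t i \<noteq> 0" "\<And>i j. c i j * t (i + j) = t i * t j * c' i j"
    using assms unfolding rescaling_equivalent_def by blast
  show ?thesis
  proof (rule rescaling_equivalentI[where t = "\<lambda>i. inverse (t i)"])
    show "c' i j * inverse (t (i + j)) = inverse (t i) * inverse (t j) * c i j" for i j
      using t(2)[of i j] t(1) by (simp add: field_simps)
  qed (use t(1) in simp)
qed

lemma rescaling_equivalent_trans:
  assumes "rescaling_equivalent c c'" "rescaling_equivalent c' c''"
  shows "rescaling_equivalent c c''"
proof -
  obtain t where t: "\<And>i. t i \<noteq> 0" "\<And>i j. c i j * t (i + j) = t i * t j * c' i j"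
    using assms(1) unfolding rescaling_equivalent_def by blast
  obtain s where s: "\<And>i. s i \<noteq> 0" "\<And>i j. c' i j * s (i + j) = s i * s j * c'' i j"
    using assms(2) unfolding rescaling_equivalent_def by blast
  show ?thesis
  proof (rule rescaling_equivalentI[where t = "\<lambda>i. t i * s i"])
    fix i j
    have "c i j * (t (i + j) * s (i + j)) = t i * t j * (c' i j * s (i + j))"
      using t(2)[of i j] by (simp flip: mult.assoc)
    then show "c i j * (t (i + j) * s (i + j)) = t i * s i * (t j * s j) * c'' i j"
      using s(2)[of i j] by (simp add: mult_ac)
  qed (use t(1) s(1) in simp)
qed

lemma rescaling_equivalent_support:
  assumes "rescaling_equivalent c c'"
  shows "c i j \<noteq> 0 \<longleftrightarrow> c' i j \<noteq> 0"
  using assms unfolding rescaling_equivalent_def by (metis mult_eq_0_iff)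

lemma structure_matrices_rescaling_equivalent:
  assumes c: "c \<in> structure_matrices n" and "rescaling_equivalent c c'"
  shows "c' \<in> structure_matrices n"
proof -
  obtain t where t: "\<And>i. t i \<noteq> 0" "\<And>i j. c' i j * t (i + j) = t i * t j * c i j"
    using rescaling_equivalent_sym[OF assms(2)] unfolding rescaling_equivalent_def by blast
  have c': "c' i j = t i * t j * c i j / t (i + j)" for i j
    using t by (simp add: field_simps)
  have "c' j k * c' i (j + k) = c' i j * c' (i + j) k" if "i \<ge> 1" "j \<ge> 1" "k \<ge> 1" for i j k
  proof -
    have "c' j k * c' i (j + k) = t i * t j * t k / t (i + j + k) * (c j k * c i (j + k))"
      using t(1)[of "j + k"] by (simp add: c' add.assoc)
    also have "c j k * c i (j + k) = c i j * c (i + j) k"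
      using c that unfolding structure_matrices_def by blast
    also have "t i * t j * t k / t (i + j + k) * (c i j * c (i + j) k) = c' i j * c' (i + j) k"
      using t(1)[of "i + j"] by (simp add: c')
    finally show ?thesis .
  qed
  moreover have "c' i j = c' j i" for i j
    using c by (simp add: c' structure_matrices_def add.commute[of j i])
  moreover have "c' i j = 0" if "c i j = 0" for i j
    using that by (simp add: c')
  ultimately show ?thesis
    using c unfolding structure_matrices_def by blast
qed

lemma structure_matrices_mono:
  assumes "n \<le> m"
  shows "structure_matrices n \<subseteq> structure_matrices m"
  using assms by (auto simp: structure_matrices_def)

text \<open>
  In a field, whether a product of two entries vanishes depends only on the support, and for a
  \<open>(0,1)\<close>-matrix that is all the associativity condition asks about.
\<close>

lemma support_matrix_in_structure_matrices:
  assumes "c \<in> structure_matrices n"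
  shows "support_matrix c \<in> structure_matrices n"
proof -
  have "c j k \<noteq> 0 \<and> c i (j + k) \<noteq> 0 \<longleftrightarrow> c i j \<noteq> 0 \<and> c (i + j) k \<noteq> 0"
    if "i \<ge> 1" "j \<ge> 1" "k \<ge> 1" for i j k
    using assms that unfolding structure_matrices_def mem_Collect_eq
    by (metis mult_eq_0_iff)
  then show ?thesis
    using assms by (auto simp: structure_matrices_def support_matrix_def)
qed

section \<open>Graded isomorphisms are rescalings\<close>

lemma graded_isomorphic_if_rescaling_equivalent:
  assumes "rescaling_equivalent c c'"
  shows "graded_isomorphic (dgca_of n c) (dgca_of n c')"
proof -
  obtain t where t: "\<And>i. t i \<noteq> 0" "\<And>i j. c i j * t (i + j) = t i * t j * c' i j"
    using assms unfolding rescaling_equivalent_def by blast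
  define \<phi> where "\<phi> = (\<lambda>x m. t m * x m)"
  have "bij_betw \<phi> (gcarrier (dgca_of n c)) (gcarrier (dgca_of n c'))"
    by (rule bij_betw_byWitness[where f' = "\<lambda>x m. x m / t m"])
      (auto simp: \<phi>_def dgca_of_def t(1))
  moreover have "\<phi> (gmult (dgca_of n c) x y) = gmult (dgca_of n c') (\<phi> x) (\<phi> y)" for x y
  proof
    fix m
    have coeff: "t m * (x i * y j * c i j * dgca_basis (i + j) m) =
        t i * x i * (t j * y j) * c' i j * dgca_basis (i + j) m" for i j
      using t(2)[of i j] by (auto simp: dgca_basis_def mult_ac)
    show "\<phi> (gmult (dgca_of n c) x y) m = gmult (dgca_of n c') (\<phi> x) (\<phi> y) m"
      by (simp add: \<phi>_def dgca_of_def sum_distrib_left coeff)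
  qed
  ultimately have "graded_algebra_iso (dgca_of n c) (dgca_of n c') \<phi>"
    unfolding graded_algebra_iso_def
    by (auto simp: \<phi>_def dgca_of_def algebra_simps)
  then show ?thesis
    unfolding graded_isomorphic_def by blast
qed

lemma gmult_basis_coefficient:
  assumes "c \<in> structure_matrices n" "i \<in> {1..n}" "j \<in> {1..n}"
  shows "gmult (dgca_of n c) (dgca_basis i) (dgca_basis j) (i + j) = c i j"
  unfolding gmult_basis[OF assms] by (simp add: dgca_of_def dgca_basis_def)

text \<open>
  Since \<open>\<phi>\<close> maps the line of degree \<open>i\<close> into the line of degree \<open>i\<close>, it sends \<open>p\<^sub>i\<close> to some \<open>t\<^sub>i p\<^sub>i\<close>, with
  \<open>t\<^sub>i \<noteq> 0\<close> by injectivity. Comparing the images of \<open>p\<^sub>i p\<^sub>j = c\<^sub>i\<^sub>j p\<^sub>i\<^sub>+\<^sub>j\<close> gives the rescaling equations.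
\<close>

lemma rescaling_equivalent_if_graded_isomorphic:
  assumes c: "c \<in> structure_matrices n" and c': "c' \<in> structure_matrices n"
    and "graded_isomorphic (dgca_of n c) (dgca_of n c')"
  shows "rescaling_equivalent c c'"
proof -
  let ?A = "dgca_of n c" and ?B = "dgca_of n c'"
  obtain \<phi> where iso: "graded_algebra_iso ?A ?B \<phi>"
    using assms(3) unfolding graded_isomorphic_def by blast
  have carrier: "dgca_basis i \<in> gcarrier ?A" if "i \<in> {1..n}" for i
    using that by (auto simp: dgca_of_def dgca_basis_def)
  have scale: "\<phi> (gscale ?A a x) = gscale ?B a (\<phi> x)" if "x \<in> gcarrier ?A" for a x
    using iso that unfolding graded_algebra_iso_def by blast
  have mult: "\<phi> (gmult ?A x y) = gmult ?B (\<phi> x) (\<phi> y)"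
    if "x \<in> gcarrier ?A" "y \<in> gcarrier ?A" for x y
    using iso that unfolding graded_algebra_iso_def by blast
  have inj: "inj_on \<phi> (gcarrier ?A)"
    using iso unfolding graded_algebra_iso_def bij_betw_def by blast
  have zero: "(\<lambda>_. 0) \<in> gcarrier ?A"
    by (simp add: dgca_of_def)
  have \<phi>_zero: "\<phi> (\<lambda>_. 0) = (\<lambda>_. 0)"
    using scale[OF zero, of 0] by (simp add: dgca_of_def)
  \<comment> \<open>Outside the range of indices any nonzero value will do, as the entries there vanish.\<close>
  define t where "t i = (if i \<in> {1..n} then \<phi> (dgca_basis i) i else 1)" for i
  have \<phi>_basis: "\<phi> (dgca_basis i) = (\<lambda>m. t i * dgca_basis i m)" if i: "i \<in> {1..n}" for i
  proof -
    have "dgca_basis i \<in> gcomp ?A i"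
      using i by (auto simp: dgca_of_def dgca_basis_def)
    moreover have "\<phi> ` gcomp ?A i \<subseteq> gcomp ?B i"
      using iso i unfolding graded_algebra_iso_def by simp
    ultimately have "\<phi> (dgca_basis i) \<in> gcomp ?B i"
      by blast
    then show ?thesis
      using i by (auto simp: t_def dgca_of_def dgca_basis_def fun_eq_iff)
  qed
  have t_nz: "t i \<noteq> 0" for i
  proof (cases "i \<in> {1..n}")
    case True
    show ?thesis
    proof
      assume "t i = 0"
      then have "\<phi> (dgca_basis i) = \<phi> (\<lambda>_. 0)"
        using \<phi>_basis[OF True] \<phi>_zero by simp
      then have "dgca_basis i = (\<lambda>_. 0 :: 'a)"
        using inj carrier[OF True] zero by (auto dest: inj_onD)
      then show False
        by (auto simp: dgca_basis_def fun_eq_iff split: if_splits)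
    qed
  qed (auto simp: t_def)
  show ?thesis
  proof (rule rescaling_equivalentI[OF t_nz])
    fix i j
    show "c i j * t (i + j) = t i * t j * c' i j"
    proof (cases "i \<in> {1..n} \<and> j \<in> {1..n} \<and> i + j \<le> n")
      case True
      then have ij: "i \<in> {1..n}" "j \<in> {1..n}" "i + j \<in> {1..n}"
        by auto
      have "\<phi> (gmult ?A (dgca_basis i) (dgca_basis j)) (i + j) = c i j * t (i + j)"
        using scale[OF carrier[OF ij(3)], of "c i j"] \<phi>_basis[OF ij(3)]
        by (simp add: gmult_basis[OF c ij(1,2)]) (simp add: dgca_of_def dgca_basis_def)
      moreover have "gmult ?B (\<phi> (dgca_basis i)) (\<phi> (dgca_basis j)) (i + j) =
          t i * t j * gmult ?B (dgca_basis i) (dgca_basis j) (i + j)"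
        unfolding \<phi>_basis[OF ij(1)] \<phi>_basis[OF ij(2)]
        by (simp add: dgca_of_def sum_distrib_left mult_ac)
      ultimately show ?thesis
        using mult[OF carrier[OF ij(1)] carrier[OF ij(2)]] gmult_basis_coefficient[OF c' ij(1,2)]
        by simp
    next
      case False
      then have "c i j = 0 \<and> c' i j = 0"
        using c c' unfolding structure_matrices_def mem_Collect_eq by (meson not_le)
      then show ?thesis
        by simp
    qed
  qed
qed

text \<open>
  Needed to pass from classes of algebras, which the theorem speaks of, to classes of matrices.
\<close>

lemma inj_on_dgca_of: "inj_on (dgca_of n) (structure_matrices n)"
proof (rule inj_onI)
  fix c c' :: "nat \<Rightarrow> nat \<Rightarrow> 'a"
  assume c: "c \<in> structure_matrices n" and c': "c' \<in> structure_matrices n"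
    and eq: "dgca_of n c = dgca_of n c'"
  have "c i j = c' i j" for i j
  proof (cases "i \<in> {1..n} \<and> j \<in> {1..n}")
    case True
    then show ?thesis
      using gmult_basis_coefficient[OF c, of i j] gmult_basis_coefficient[OF c', of i j] eq
      by simp
  next
    case False
    then have "c i j = 0 \<and> c' i j = 0"
      using c c' unfolding structure_matrices_def mem_Collect_eq by meson
    then show ?thesis
      by simp
  qed
  then show "c = c'"
    by (simp add: fun_eq_iff)
qed

section \<open>Normalising the multiplication by the first basis vector\<close>

text \<open>
  Dividing by \<open>unitize x\<close> lets one formula for a scaling factor cover both the case that an entry \<open>x\<close> must
  be normalised and the case that it vanishes and imposes no condition.
\<close>

definition unitize :: "'k::field \<Rightarrow> 'k" where
  "unitize x = (if x = 0 then 1 else x)"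

lemma unitize_simps [simp]:
  "unitize x \<noteq> 0" "unitize 0 = 1" "x \<noteq> 0 \<Longrightarrow> unitize x = x"
  by (auto simp: unitize_def)

text \<open>
  The equation for \<open>c\<^sub>1\<^sub>j\<close> with \<open>t\<^sub>1 = 1\<close> reads \<open>c\<^sub>1\<^sub>j t\<^sub>j\<^sub>+\<^sub>1 = t\<^sub>j\<close>, so the equations for the first row can be
  solved by recursion on \<open>j\<close>; the product below is the solution.
\<close>

lemma rescaling_normalises_first_row:
  assumes "c \<in> structure_matrices n"
  obtains c' where "c' \<in> structure_matrices n" "rescaling_equivalent c c'"
    "\<And>j. c' 1 j = 0 \<or> c' 1 j = 1"
proof -
  define t where "t i = inverse (\<Prod>k=1..<i. unitize (c 1 k))" for i
  define c' where "c' i j = c i j * t (i + j) / (t i * t j)" for i j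
  have t: "t i \<noteq> 0" for i
    by (simp add: t_def)
  have t_Suc: "t (Suc j) * unitize (c 1 j) = t j" if "j \<ge> 1" for j
    using that by (simp add: t_def)
  have t_1: "t 1 = 1"
    by (simp add: t_def)
  have "rescaling_equivalent c c'"
    by (rule rescaling_equivalentI[where t = t]) (use t in \<open>auto simp: c'_def\<close>)
  moreover have "c' 1 j = 0 \<or> c' 1 j = 1" for j
  proof (cases "c 1 j = 0")
    case False
    then have "j \<ge> 1"
      using assms unfolding structure_matrices_def by force
    then have "c 1 j * t (Suc j) = t j"
      using t_Suc[of j] False by (simp add: mult.commute)
    then show ?thesis
      using t[of j] t_1 by (simp add: c'_def)
  qed (simp add: c'_def)
  ultimately show thesis
    using that structure_matrices_rescaling_equivalent[OF assms] by blast
qed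

section \<open>Reduction to the support in dimension seven\<close>

text \<open>
  The twelve monomial equations to which a solution of the rescaling problem in dimension 7 reduces,
  by symmetry and because a nonzero entry has \<open>i, j \<ge> 1\<close> and \<open>i + j \<le> 7\<close>.
\<close>

lemma rescaling_equivalent_support_matrixI:
  fixes t1 :: "'k::field"
  assumes c: "c \<in> structure_matrices 7"
    and nz: "t1 \<noteq> 0" "t2 \<noteq> 0" "t3 \<noteq> 0" "t4 \<noteq> 0" "t5 \<noteq> 0" "t6 \<noteq> 0" "t7 \<noteq> 0"
    and eqs:
      "c 1 1 \<noteq> 0 \<Longrightarrow> c 1 1 * t2 = t1 * t1"
      "c 1 2 \<noteq> 0 \<Longrightarrow> c 1 2 * t3 = t1 * t2"
      "c 1 3 \<noteq> 0 \<Longrightarrow> c 1 3 * t4 = t1 * t3"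
      "c 1 4 \<noteq> 0 \<Longrightarrow> c 1 4 * t5 = t1 * t4"
      "c 1 5 \<noteq> 0 \<Longrightarrow> c 1 5 * t6 = t1 * t5"
      "c 1 6 \<noteq> 0 \<Longrightarrow> c 1 6 * t7 = t1 * t6"
      "c 2 2 \<noteq> 0 \<Longrightarrow> c 2 2 * t4 = t2 * t2"
      "c 2 3 \<noteq> 0 \<Longrightarrow> c 2 3 * t5 = t2 * t3"
      "c 2 4 \<noteq> 0 \<Longrightarrow> c 2 4 * t6 = t2 * t4"
      "c 2 5 \<noteq> 0 \<Longrightarrow> c 2 5 * t7 = t2 * t5"
      "c 3 3 \<noteq> 0 \<Longrightarrow> c 3 3 * t6 = t3 * t3"
      "c 3 4 \<noteq> 0 \<Longrightarrow> c 3 4 * t7 = t3 * t4"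
  shows "rescaling_equivalent c (support_matrix c)"
proof -
  define t where "t i = (if i \<in> {1..7} then [t1, t2, t3, t4, t5, t6, t7] ! (i - 1) else 1)" for i :: nat
  have t_vals: "t 1 = t1" "t 2 = t2" "t 3 = t3" "t 4 = t4" "t 5 = t5" "t 6 = t6" "t 7 = t7"
    by (simp_all add: t_def)
  have sym: "c i j = c j i" for i j
    using c by (simp add: structure_matrices_def)
  have t_nz: "t i \<noteq> 0" for i
  proof (cases "i \<in> {1..7}")
    case True
    then have "i \<in> {1, 2, 3, 4, 5, 6, 7}"
      by auto
    then show ?thesis
      using nz t_vals by auto
  qed (auto simp: t_def)
  have eq_le: "c i j * t (i + j) = t i * t j" if nz_ij: "c i j \<noteq> 0" and "i \<le> j" for i j
  proof -
    have "i \<ge> 1" "i + j \<le> 7"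
      using c nz_ij unfolding structure_matrices_def by force+
    then have "(i, j) \<in> {(1,1), (1,2), (1,3), (1,4), (1,5), (1,6), (2,2), (2,3), (2,4), (2,5),
        (3,3), (3,4)}"
      using \<open>i \<le> j\<close> by simp presburger
    then show ?thesis
      using eqs nz_ij t_vals by (auto simp: eval_nat_numeral)
  qed
  have "c i j * t (i + j) = t i * t j" if "c i j \<noteq> 0" for i j
    using eq_le[of i j] eq_le[of j i] that sym[of i j] by (metis nat_le_linear add.commute mult.commute)
  then show ?thesis
    by (intro rescaling_equivalentI[OF t_nz]) (auto simp: support_matrix_def)
qed

text \<open>
  The associativity conditions on the triple products of \<open>p\<^sub>i, p\<^sub>j, p\<^sub>k\<close> with \<open>i + j + k \<le> 7\<close>, omitting those
  that commutativity makes trivial. A multiset of three distinct indices yields two equations.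
\<close>

lemma structure_matrix_7_relations:
  assumes "c \<in> structure_matrices 7"
  shows "c 1 1 * c 2 2 = c 1 2 * c 1 3"
    "c 1 1 * c 2 3 = c 1 3 * c 1 4"
    "c 1 1 * c 2 4 = c 1 4 * c 1 5"
    "c 1 1 * c 2 5 = c 1 5 * c 1 6"
    "c 1 2 * c 2 3 = c 2 2 * c 1 4"
    "c 1 2 * c 3 3 = c 2 3 * c 1 5"
    "c 1 3 * c 2 4 = c 2 3 * c 1 5"
    "c 1 2 * c 3 4 = c 2 4 * c 1 6"
    "c 1 4 * c 2 5 = c 2 4 * c 1 6"
    "c 1 3 * c 3 4 = c 3 3 * c 1 6"
    "c 2 2 * c 3 4 = c 2 3 * c 2 5"
proof -
  have sym: "c i j = c j i" for i j
    using assms by (simp add: structure_matrices_def)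
  have assoc: "c i j * c a k = c j k * c i b"
    if "i + j = a" "j + k = b" "i \<ge> 1" "j \<ge> 1" "k \<ge> 1" for i j k a b
    using assms that by (auto simp: structure_matrices_def)
  show "c 1 1 * c 2 2 = c 1 2 * c 1 3"
    using assoc[of 1 1 2 2 3] by (simp add: mult.commute)
  show "c 1 1 * c 2 3 = c 1 3 * c 1 4"
    using assoc[of 1 1 2 3 4] by (simp add: mult.commute)
  show "c 1 1 * c 2 4 = c 1 4 * c 1 5"
    using assoc[of 1 1 2 4 5] by (simp add: mult.commute)
  show "c 1 1 * c 2 5 = c 1 5 * c 1 6"
    using assoc[of 1 1 2 5 6] by (simp add: mult.commute)
  show "c 1 2 * c 2 3 = c 2 2 * c 1 4"
    using assoc[of 1 2 3 2 4] sym[of 3 2] by (simp add: mult.commute)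
  show "c 1 2 * c 3 3 = c 2 3 * c 1 5"
    using assoc[of 1 2 3 3 5] by (simp add: mult.commute)
  show "c 1 3 * c 2 4 = c 2 3 * c 1 5"
    using assoc[of 1 3 4 2 5] sym[of 4 2] sym[of 3 2] by (simp add: mult.commute)
  show "c 1 2 * c 3 4 = c 2 4 * c 1 6"
    using assoc[of 1 2 3 4 6] by (simp add: mult.commute)
  show "c 1 4 * c 2 5 = c 2 4 * c 1 6"
    using assoc[of 1 4 5 2 6] sym[of 5 2] sym[of 4 2] by (simp add: mult.commute)
  show "c 1 3 * c 3 4 = c 3 3 * c 1 6"
    using assoc[of 1 3 4 3 6] sym[of 4 3] by (simp add: mult.commute)
  show "c 2 2 * c 3 4 = c 2 3 * c 2 5"
    using assoc[of 2 2 4 3 5] sym[of 4 3] by (simp add: mult.commute)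
qed

text \<open>
  As \<open>c\<^sub>1\<^sub>1 = 1\<close>, associativity gives \<open>c\<^sub>2\<^sub>k = c\<^sub>1\<^sub>k c\<^sub>1\<^sub>k\<^sub>+\<^sub>1\<close>, which is already 0 or 1; only \<open>c\<^sub>3\<^sub>3\<close> and \<open>c\<^sub>3\<^sub>4\<close> are
  left. If \<open>c\<^sub>1\<^sub>2 = 1\<close> they are determined by the first row as well. Otherwise \<open>c\<^sub>2\<^sub>2 = 0\<close> and the triple products
  of \<open>p\<^sub>1, p\<^sub>2\<close> and \<open>p\<^sub>3\<close> or \<open>p\<^sub>4\<close> vanish, which says \<open>c\<^sub>1\<^sub>3 c\<^sub>1\<^sub>4 c\<^sub>1\<^sub>5 = c\<^sub>1\<^sub>4 c\<^sub>1\<^sub>5 c\<^sub>1\<^sub>6 = 0\<close>. Hence the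
  indices 3 and 6, and likewise 4 and 7, lie in different chains, so that rescaling along the chains
  of 3, 6 and 7 can still normalise the two entries.
\<close>

lemma support_normal_form_of_nonzero_square:
  fixes c :: "nat \<Rightarrow> nat \<Rightarrow> 'k::field"
  assumes c: "c \<in> structure_matrices 7"
    and row: "\<And>j. c 1 j = 0 \<or> c 1 j = 1" and e1: "c 1 1 = 1"
  shows "rescaling_equivalent c (support_matrix c)"
proof -
  note rel = structure_matrix_7_relations[OF c]
  note I = rescaling_equivalent_support_matrixI[OF c]
  note split_row = row[of 2] row[of 3] row[of 4] row[of 5] row[of 6]
  define u where "u = unitize (c 3 3)"
  define v where "v = unitize (c 3 4)"
  have uv: "u \<noteq> 0" "v \<noteq> 0" "c 3 3 \<noteq> 0 \<Longrightarrow> u = c 3 3" "c 3 4 \<noteq> 0 \<Longrightarrow> v = c 3 4"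
    by (simp_all add: u_def v_def)
  consider "c 1 2 = 1" | "c 1 2 = 0" "c 1 3 = 1" | "c 1 2 = 0" "c 1 3 = 0" "c 1 6 = 0"
    | "c 1 2 = 0" "c 1 3 = 0" "c 1 6 = 1"
    using split_row by blast
  then show ?thesis
  proof cases
    \<comment> \<open>All entries are 0 or 1 already.\<close>
    case 1
    show ?thesis
      by (rule I[of 1 1 1 1 1 1 1]) (use rel e1 1 split_row in auto)
  next
    \<comment> \<open>Now \<open>c\<^sub>3\<^sub>4 = c\<^sub>3\<^sub>3 c\<^sub>1\<^sub>6\<close>, so scaling the chain of 6 normalises both entries. That chain cannot reach
      down to 4, because \<open>c\<^sub>1\<^sub>4 c\<^sub>1\<^sub>5 = 0\<close>.\<close>
    case 2
    define t5 where "t5 = (if c 1 5 = 0 then 1 else 1 / u)"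
    define t7 where "t7 = (if c 1 6 = 0 then 1 else 1 / u)"
    show ?thesis
      by (rule I[of 1 1 1 1 t5 "1 / u" t7])
        (use rel e1 2 split_row uv in \<open>auto simp: t5_def t7_def\<close>)
  next
    \<comment> \<open>The index 7 is a chain by itself: the chain of 6, which may contain 4 and 5, normalises \<open>c\<^sub>3\<^sub>3\<close>,
      and then \<open>t\<^sub>7\<close> is free to normalise \<open>c\<^sub>3\<^sub>4\<close>.\<close>
    case 3
    define t5 where "t5 = (if c 1 5 = 0 then 1 else 1 / u)"
    define t4 where "t4 = (if c 1 4 = 0 then 1 else t5)"
    show ?thesis
      by (rule I[of 1 1 1 t4 t5 "1 / u" "t4 / v"])
        (use rel e1 3 split_row uv in \<open>auto simp: t4_def t5_def\<close>)
  next
    \<comment> \<open>Here \<open>c\<^sub>3\<^sub>3 = 0\<close> and 3 is a chain by itself.\<close>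
    case 4
    show ?thesis
      by (rule I[of 1 1 v 1 1 1 1]) (use rel e1 4 split_row uv in auto)
  qed
qed

text \<open>
  As \<open>c\<^sub>1\<^sub>1 = 0\<close>, associativity gives \<open>c\<^sub>1\<^sub>k c\<^sub>1\<^sub>k\<^sub>+\<^sub>1 = 0\<close> for \<open>2 \<le> k \<le> 5\<close>, so that chains have at most two elements.
  The cases are ordered by the first link \<open>c\<^sub>1\<^sub>j = 1\<close> among \<open>j = 2, 3, 4, 5\<close>. Every nonzero entry \<open>c\<^sub>i\<^sub>j\<close> asks for
  \<open>t\<^sub>i\<^sub>+\<^sub>j = t\<^sub>i t\<^sub>j / c\<^sub>i\<^sub>j\<close>. Where two such equations for the same degree compete, either a relation identifies
  them or a factor of lower degree is still free and, once \<open>t\<^sub>2\<close> has been put equal to 1 or to \<open>t\<^sub>3\<close>, occurs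
  in their quotient with exponent \<open>\<plusminus>1\<close>.
\<close>

lemma support_normal_form_of_zero_square:
  fixes c :: "nat \<Rightarrow> nat \<Rightarrow> 'k::field"
  assumes c: "c \<in> structure_matrices 7"
    and row: "\<And>j. c 1 j = 0 \<or> c 1 j = 1" and e1: "c 1 1 = 0"
  shows "rescaling_equivalent c (support_matrix c)"
proof -
  note rel = structure_matrix_7_relations[OF c]
  note I = rescaling_equivalent_support_matrixI[OF c]
  note split_row = row[of 2] row[of 3] row[of 4] row[of 5] row[of 6]
  define u22 where "u22 = unitize (c 2 2)"
  define u23 where "u23 = unitize (c 2 3)"
  define u24 where "u24 = unitize (c 2 4)"
  define u25 where "u25 = unitize (c 2 5)"
  define u33 where "u33 = unitize (c 3 3)"
  define u34 where "u34 = unitize (c 3 4)"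
  have u: "u22 \<noteq> 0" "u23 \<noteq> 0" "u24 \<noteq> 0" "u25 \<noteq> 0" "u33 \<noteq> 0" "u34 \<noteq> 0"
    "c 2 2 \<noteq> 0 \<Longrightarrow> u22 = c 2 2" "c 2 3 \<noteq> 0 \<Longrightarrow> u23 = c 2 3" "c 2 4 \<noteq> 0 \<Longrightarrow> u24 = c 2 4"
    "c 2 5 \<noteq> 0 \<Longrightarrow> u25 = c 2 5" "c 3 3 \<noteq> 0 \<Longrightarrow> u33 = c 3 3" "c 3 4 \<noteq> 0 \<Longrightarrow> u34 = c 3 4"
    by (simp_all add: u22_def u23_def u24_def u25_def u33_def u34_def)
  \<comment> \<open>If \<open>p\<^sub>2p\<^sub>3\<close> and \<open>p\<^sub>2p\<^sub>5\<close> are nonzero, then so is \<open>(p\<^sub>2p\<^sub>3)p\<^sub>2\<close>, which equals \<open>(p\<^sub>2p\<^sub>2)p\<^sub>3\<close>.\<close>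
  have nz: "c 2 2 \<noteq> 0 \<and> c 3 4 \<noteq> 0" if "c 2 3 \<noteq> 0" "c 2 5 \<noteq> 0"
    using rel(11) that by auto
  consider "c 1 2 = 1" | "c 1 2 = 0" "c 1 3 = 1" | "c 1 2 = 0" "c 1 3 = 0" "c 1 4 = 1"
    | "c 1 2 = 0" "c 1 3 = 0" "c 1 4 = 0" "c 1 5 = 1" "c 2 2 = 0"
    | "c 1 2 = 0" "c 1 3 = 0" "c 1 4 = 0" "c 1 5 = 1" "c 3 4 = 0"
    | "c 1 2 = 0" "c 1 3 = 0" "c 1 4 = 0" "c 1 5 = 0"
    using split_row rel by fastforce
  then show ?thesis
  proof cases
    \<comment> \<open>Here \<open>c\<^sub>3\<^sub>3 = 0\<close>, \<open>c\<^sub>2\<^sub>3 = c\<^sub>2\<^sub>2 c\<^sub>1\<^sub>4\<close> and \<open>c\<^sub>3\<^sub>4 = c\<^sub>2\<^sub>4 c\<^sub>1\<^sub>6\<close>, so that only \<open>c\<^sub>2\<^sub>2, c\<^sub>2\<^sub>4, c\<^sub>2\<^sub>5\<close> need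
      normalising. The condition on \<open>c\<^sub>2\<^sub>5\<close> is met by \<open>t\<^sub>5\<close> if 5 is a chain by itself, and by \<open>t\<^sub>7\<close> if
      5 is linked to 6; if 5 is linked to 4, either \<open>c\<^sub>2\<^sub>5\<close> vanishes or \<open>c\<^sub>2\<^sub>5 = c\<^sub>2\<^sub>4\<close>.\<close>
    case 1
    define t4 where "t4 = 1 / u22"
    define t6 where "t6 = t4 / u24"
    define t5 where "t5 = (if c 1 4 = 1 then t4 else if c 1 5 = 1 then t6 else u25 * t6)"
    define t7 where "t7 = (if c 1 5 = 1 then t6 / u25 else t6)"
    show ?thesis
      by (rule I[of 1 1 1 t4 t5 t6 t7])
        (use rel e1 1 split_row u in \<open>auto simp: t4_def t5_def t6_def t7_def\<close>)
  next
    \<comment> \<open>The factor \<open>t\<^sub>3 = t\<^sub>4\<close> is fixed by \<open>c\<^sub>2\<^sub>2 t\<^sub>4 = t\<^sub>2\<^sup>2\<close>. If 6 and 7 are linked, \<open>t\<^sub>7\<close> is not free, and \<open>t\<^sub>5\<close> must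
      serve both \<open>c\<^sub>2\<^sub>3\<close> and \<open>c\<^sub>2\<^sub>5\<close>; when both are nonzero \<open>c\<^sub>2\<^sub>2 c\<^sub>3\<^sub>4 = c\<^sub>2\<^sub>3 c\<^sub>2\<^sub>5\<close> makes the two demands agree.\<close>
    case 2
    define t3 where "t3 = 1 / u22"
    define t6 where "t6 = t3\<^sup>2 / u33"
    define t5 where "t5 = (if c 1 5 = 1 then t6 else
      if c 1 6 = 1 \<and> c 2 3 = 0 then u25 * t6 else t3 / u23)"
    define t7 where "t7 = (if c 1 6 = 1 then t6 else t5 / u25)"
    show ?thesis
      by (rule I[of 1 1 t3 t3 t5 t6 t7])
        (use rel e1 2 split_row u nz in \<open>auto simp: t3_def t5_def t6_def t7_def field_simps power2_eq_square\<close>)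
  next
    \<comment> \<open>With \<open>t\<^sub>2 = 1\<close> and \<open>t\<^sub>4 = t\<^sub>5 = t\<^sub>3 / c\<^sub>2\<^sub>3\<close>, degree 6 asks for \<open>t\<^sub>3 / (c\<^sub>2\<^sub>3 c\<^sub>2\<^sub>4) = t\<^sub>3\<^sup>2 / c\<^sub>3\<^sub>3\<close>, which
      determines \<open>t\<^sub>3\<close>. If 6 and 7 are linked, \<open>c\<^sub>2\<^sub>4\<close> and \<open>c\<^sub>3\<^sub>3\<close> vanish and degree 7 decides.\<close>
    case 3
    define t3 where "t3 = u33 / (u23 * u24)"
    define t4 where "t4 = t3 / u23"
    define t7 where "t7 = t3 * t4 / u34"
    define t6 where "t6 = (if c 1 6 = 1 then t7 else t3\<^sup>2 / u33)"
    show ?thesis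
      by (rule I[of 1 1 t3 t4 t4 t6 t7])
        (use rel e1 3 split_row u in \<open>auto simp: t3_def t4_def t6_def t7_def field_simps power2_eq_square\<close>)
  next
    \<comment> \<open>Here \<open>t\<^sub>4\<close> is free and is used for \<open>c\<^sub>2\<^sub>4\<close>. Then degree 7 asks for \<open>t\<^sub>3 t\<^sub>4 / c\<^sub>3\<^sub>4 = t\<^sub>5 / c\<^sub>2\<^sub>5\<close> with \<open>t\<^sub>4\<close>
      proportional to \<open>t\<^sub>6 = t\<^sub>5\<close>, which is linear in \<open>t\<^sub>3\<close>.\<close>
    case 4
    define t3 where "t3 = u34 / (u24 * u25)"
    define t6 where "t6 = t3\<^sup>2 / u33"
    show ?thesis
      by (rule I[of 1 1 t3 "u24 * t6" t6 t6 "t6 / u25"])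
        (use rel e1 4 split_row u in \<open>auto simp: t3_def t6_def field_simps power2_eq_square\<close>)
  next
    \<comment> \<open>The conditions on \<open>c\<^sub>2\<^sub>2, c\<^sub>2\<^sub>4, c\<^sub>3\<^sub>3\<close> prescribe \<open>t\<^sub>2\<^sup>3 / t\<^sub>3\<^sup>2\<close>; put \<open>t\<^sub>2 = t\<^sub>3 = s\<close>.\<close>
    case 5
    define s where "s = u22 * u24 / u33"
    define t6 where "t6 = s\<^sup>2 / u33"
    show ?thesis
      by (rule I[of 1 s s "s\<^sup>2 / u22" t6 t6 "s * t6 / u25"])
        (use rel e1 5 split_row u in \<open>auto simp: s_def t6_def field_simps power2_eq_square\<close>)
  next
    \<comment> \<open>As in the previous case, \<open>t\<^sub>2 = t\<^sub>3 = s\<close> settles degree 6. Degree 7 is settled by \<open>c\<^sub>3\<^sub>4\<close>, and \<open>t\<^sub>5\<close> serves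
      \<open>c\<^sub>2\<^sub>3\<close> and \<open>c\<^sub>2\<^sub>5\<close>, which are compatible by \<open>c\<^sub>2\<^sub>2 c\<^sub>3\<^sub>4 = c\<^sub>2\<^sub>3 c\<^sub>2\<^sub>5\<close>. If 6 and 7 are linked, \<open>c\<^sub>2\<^sub>4\<close> and \<open>c\<^sub>3\<^sub>3\<close>
      vanish, so that \<open>t\<^sub>6\<close> may be taken equal to \<open>t\<^sub>7\<close>.\<close>
    case 6
    define s where "s = u22 * u24 / u33"
    define t4 where "t4 = s\<^sup>2 / u22"
    define t7 where "t7 = s * t4 / u34"
    define t5 where "t5 = (if c 2 3 = 0 then u25 * t7 / s else s\<^sup>2 / u23)"
    define t6 where "t6 = (if c 1 6 = 1 then t7 else s\<^sup>2 / u33)"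
    show ?thesis
      by (rule I[of 1 s s t4 t5 t6 t7])
        (use rel e1 6 split_row u nz in
          \<open>auto simp: s_def t4_def t5_def t6_def t7_def field_simps power2_eq_square\<close>)
  qed
qed

lemma rescaling_equivalent_support_matrix:
  fixes c :: "nat \<Rightarrow> nat \<Rightarrow> 'k::field"
  assumes "c \<in> structure_matrices n" "n \<le> 7"
  shows "rescaling_equivalent c (support_matrix c)"
proof -
  have "c \<in> structure_matrices 7"
    using assms structure_matrices_mono by blast
  then obtain c' where c': "c' \<in> structure_matrices 7" "rescaling_equivalent c c'"
    "\<And>j. c' 1 j = 0 \<or> c' 1 j = 1"
    using rescaling_normalises_first_row by blast
  have "rescaling_equivalent c' (support_matrix c')"
    using c'(1,3) c'(3)[of 1] support_normal_form_of_nonzero_square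
      support_normal_form_of_zero_square by blast
  moreover have "support_matrix c' = support_matrix c"
    using rescaling_equivalent_support[OF c'(2)] by (simp add: support_matrix_def fun_eq_iff)
  ultimately show ?thesis
    using rescaling_equivalent_trans[OF c'(2)] by simp
qed

section \<open>Classification\<close>

lemma graded_isomorphic_iff_same_support:
  fixes c :: "nat \<Rightarrow> nat \<Rightarrow> 'k::field"
  assumes "n \<le> 7" "c \<in> structure_matrices n" "c' \<in> structure_matrices n"
  shows "graded_isomorphic (dgca_of n c) (dgca_of n c') \<longleftrightarrow> (c, c') \<in> same_support_rel n"
proof
  assume "graded_isomorphic (dgca_of n c) (dgca_of n c')"
  then have "rescaling_equivalent c c'"
    using rescaling_equivalent_if_graded_isomorphic assms(2,3) by blast
  then show "(c, c') \<in> same_support_rel n"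
    using rescaling_equivalent_support[of c c'] assms(2,3) by (simp add: same_support_rel_def)
next
  assume "(c, c') \<in> same_support_rel n"
  then have "support_matrix c = support_matrix c'"
    by (simp add: same_support_rel_def support_matrix_def fun_eq_iff)
  then have "rescaling_equivalent c c'"
    using rescaling_equivalent_support_matrix[OF assms(2,1)]
      rescaling_equivalent_support_matrix[OF assms(3,1)]
      rescaling_equivalent_sym rescaling_equivalent_trans by metis
  then show "graded_isomorphic (dgca_of n c) (dgca_of n c')"
    by (rule graded_isomorphic_if_rescaling_equivalent)
qed

theorem theorem2p6:
  fixes n :: nat
  assumes "1 \<le> n" and "n \<le> 7"
  shows "(\<forall>C \<in> (structure_matrices n :: (nat \<Rightarrow> nat \<Rightarrow> 'k::field) set). \<forall>C' \<in> structure_matrices n.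
            graded_isomorphic (dgca_of n C) (dgca_of n C') \<longleftrightarrow> (C, C') \<in> same_support_rel n) \<and>
         (\<exists>F. bij_betw F (dgcas n // dgca_iso_rel n)
                (structure_matrices n // (same_support_rel n :: ((nat \<Rightarrow> nat \<Rightarrow> 'k) \<times> (nat \<Rightarrow> nat \<Rightarrow> 'k)) set)) \<and>
              (\<forall>C \<in> structure_matrices n.
                 F (dgca_iso_rel n `` {dgca_of n C}) = same_support_rel n `` {C})) \<and>
         (\<forall>X \<in> dgcas n // (dgca_iso_rel n ::
                (('k, nat \<Rightarrow> 'k) graded_algebra \<times> ('k, nat \<Rightarrow> 'k) graded_algebra) set).
            \<exists>!C. C \<in> zero_one_matrices n \<and> dgca_of n C \<in> X)"
proof -
  let ?M = "structure_matrices n :: (nat \<Rightarrow> nat \<Rightarrow> 'k) set"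
  let ?S = "same_support_rel n :: ((nat \<Rightarrow> nat \<Rightarrow> 'k) \<times> (nat \<Rightarrow> nat \<Rightarrow> 'k)) set"
  let ?R = "dgca_iso_rel n :: (('k, nat \<Rightarrow> 'k) graded_algebra \<times> ('k, nat \<Rightarrow> 'k) graded_algebra) set"
  let ?D = "dgcas n :: ('k, nat \<Rightarrow> 'k) graded_algebra set"
  note iso_iff = graded_isomorphic_iff_same_support[OF assms(2), where 'k = 'k]
  have S_sub: "?S `` {C} \<subseteq> ?M" for C
    by (auto simp: same_support_rel_def)
  \<comment> \<open>By injectivity of \<open>dgca_of\<close>, isomorphism classes are exactly the images of support classes, and
    everything else is transport along this bijection.\<close>
  have iso_class: "?R `` {dgca_of n C} = dgca_of n ` (?S `` {C})" if "C \<in> ?M" for C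
    using that iso_iff S_sub[of C] by (auto simp: dgca_iso_rel_def dgcas_def)
  have "bij_betw ((`) (dgca_of n)) (?M // ?S) (?D // ?R)"
    unfolding bij_betw_def
  proof
    have "?M // ?S \<subseteq> Pow ?M"
      using S_sub by (auto simp: quotient_def)
    then show "inj_on ((`) (dgca_of n)) (?M // ?S)"
      using inj_on_image_Pow[OF inj_on_dgca_of] inj_on_subset by blast
    show "(`) (dgca_of n) ` (?M // ?S) = ?D // ?R"
      using iso_class by (auto simp: quotient_def dgcas_def)
  qed
  note bij = this
  define F where "F = inv_into (?M // ?S) ((`) (dgca_of n))"
  have "bij_betw F (?D // ?R) (?M // ?S)"
    unfolding F_def by (rule bij_betw_inv_into[OF bij])
  moreover have "F (?R `` {dgca_of n C}) = ?S `` {C}" if "C \<in> ?M" for C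
    using inv_into_f_f[OF bij_betw_imp_inj_on[OF bij] quotientI[OF that]]
    by (simp add: F_def iso_class[OF that])
  moreover have "\<exists>!C. C \<in> zero_one_matrices n \<and> dgca_of n C \<in> X" if X: "X \<in> ?D // ?R" for X
  proof -
    obtain C where C: "C \<in> ?M" "X = dgca_of n ` (?S `` {C})"
      using X iso_class by (auto simp: quotient_def dgcas_def)
    have mem_X: "dgca_of n C' \<in> X \<longleftrightarrow> (C, C') \<in> ?S" if "C' \<in> ?M" for C'
      using inj_on_image_mem_iff[OF inj_on_dgca_of that S_sub] C(2) by simp
    show ?thesis
    proof (rule ex1I[of _ "support_matrix C"])
      show "support_matrix C \<in> zero_one_matrices n \<and> dgca_of n (support_matrix C) \<in> X"
        using support_matrix_in_structure_matrices[OF C(1)] mem_X C(1)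
        by (auto simp: zero_one_matrices_def same_support_rel_def support_matrix_def)
    next
      fix C' assume C': "C' \<in> zero_one_matrices n \<and> dgca_of n C' \<in> X"
      then have "(C, C') \<in> ?S" "\<And>i j. C' i j = 0 \<or> C' i j = 1"
        using mem_X by (auto simp: zero_one_matrices_def)
      then show "C' = support_matrix C"
        by (auto simp: same_support_rel_def support_matrix_def fun_eq_iff)
    qed
  qed
  ultimately show ?thesis
    using iso_iff by blast
qed

end
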